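(* Let $H_1, H_2, \ldots, H_k$ be $k$ groups (not necessarily finite) and let $G = H_1 \times H_2 \times \cdots \times H_k$. Fix $j\in \{1,\ldots ,k\}$, let $\pi_j : G \to H_j$ denote the projection, and let $M_j$ and $N_j$ be two normal subgroups of $H_j$. Put $M=\{1\} \times \cdots \times M_j \times \cdots \times \{1\}$ (with $M_j$ in the $j$-th position and the trivial group in all others) and $N = H_1 \times \cdots \times N_j \times \cdots \times H_k$ (with $N_j$ in the $j$-th position and $H_i$ in the $i$-th position for $i \neq j$). Then: (1) For each $f \in Aut_{N}^{M}(G)$ the map $\alpha_f : H_j \rightarrow H_j$ given by $\alpha_{f}(h_j) = \pi_j( f(1,\ldots,h_j,\ldots,1))$ (with $h_j$ in the $j$-th position) is an automorphism of $H_j$ and it belongs to $Aut_{N_j}^{M_j}(H_j)$. (2) The map $\phi : Aut_{N}^{M}(G) \rightarrow Aut_{N_j}^{M_j}(H_j)$ given by $\phi(f) = \alpha_{f}$ is a group isomorphism.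
   Context: For a group $G$ with normal subgroups $M$ and $N$: $Aut^{M}(G)$ denotes the group of all automorphisms of $G$ which fix $M$ setwise and act trivially on $G/M$ (i.e. $g^{-1}f(g)\in M$ for all $g \in G$); $Aut_{N}(G)$ denotes the group of all automorphisms of $G$ which fix $N$ elementwise; and $Aut_{N}^{M}(G) = Aut^{M}(G)\cap Aut_{N}(G)$. The same notation is used for $H_j$ with its normal subgroups $M_j$, $N_j$. *)

theory Defs
  imports "HOL-Algebra.Product_Groups" "HOL-Algebra.Bij"
begin

text \<open>Automorphisms are the elements of \<^const>\<open>auto\<close>, hence extensional on the carrier;
  the group operation of \<^const>\<open>AutoGroup\<close> is composition.
  Below, \<open>aut_upper G M\<close>, \<open>aut_lower G N\<close> and \<open>aut_both G M N\<close> are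
  $Aut^M(G)$, $Aut_N(G)$ and $Aut_N^M(G)$.\<close>

definition aut_upper :: "('a, 'b) monoid_scheme \<Rightarrow> 'a set \<Rightarrow> ('a \<Rightarrow> 'a) set" where
  "aut_upper G M =
     {f \<in> auto G. f ` M = M \<and> (\<forall>g \<in> carrier G. inv\<^bsub>G\<^esub> g \<otimes>\<^bsub>G\<^esub> f g \<in> M)}"

definition aut_lower :: "('a, 'b) monoid_scheme \<Rightarrow> 'a set \<Rightarrow> ('a \<Rightarrow> 'a) set" where
  "aut_lower G N = {f \<in> auto G. \<forall>n \<in> N. f n = n}"

definition aut_both :: "('a, 'b) monoid_scheme \<Rightarrow> 'a set \<Rightarrow> 'a set \<Rightarrow> ('a \<Rightarrow> 'a) set" where
  "aut_both G M N = aut_upper G M \<inter> aut_lower G N"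

definition aut_both_group ::
    "('a, 'b) monoid_scheme \<Rightarrow> 'a set \<Rightarrow> 'a set \<Rightarrow> ('a \<Rightarrow> 'a) monoid" where
  "aut_both_group G M N = AutoGroup G \<lparr>carrier := aut_both G M N\<rparr>"

definition factor_embed ::
    "'i set \<Rightarrow> ('i \<Rightarrow> ('a, 'b) monoid_scheme) \<Rightarrow> 'i \<Rightarrow> 'a \<Rightarrow> ('i \<Rightarrow> 'a)" where
  "factor_embed I H j h = (\<lambda>i\<in>I. if i = j then h else \<one>\<^bsub>H i\<^esub>)"

definition factor_aut ::
    "'i set \<Rightarrow> ('i \<Rightarrow> ('a, 'b) monoid_scheme) \<Rightarrow> 'i \<Rightarrow> (('i \<Rightarrow> 'a) \<Rightarrow> ('i \<Rightarrow> 'a)) \<Rightarrow> 'a \<Rightarrow> 'a" where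
  "factor_aut I H j f = (\<lambda>h \<in> carrier (H j). f (factor_embed I H j h) j)"

lemma subgroup_aut_both:
  assumes "M \<lhd> G" and "N \<lhd> G"
  shows "subgroup (aut_both G M N) (AutoGroup G)"
proof -
  interpret M: normal M G by fact
  interpret N: normal N G by fact
  interpret A: group "AutoGroup G" by (rule M.AutoGroup)
  have Msub: "M \<subseteq> carrier G" and Nsub: "N \<subseteq> carrier G"
    by (rule M.subset, rule N.subset)
  have car: "carrier (AutoGroup G) = auto G" by (simp add: AutoGroup_def)
  have mlt: "f \<otimes>\<^bsub>AutoGroup G\<^esub> g = compose (carrier G) f g"
    if "f \<in> auto G" "g \<in> auto G" for f g
    using that by (simp add: AutoGroup_def BijGroup_def auto_def)
  have mem: "f x \<in> carrier G" if "f \<in> auto G" "x \<in> carrier G" for f x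
    using that by (auto simp: auto_def hom_def)
  have tr: "f x = f y \<longleftrightarrow> x = y" if "f \<in> auto G" "x \<in> carrier G" "y \<in> carrier G" for f x y
    using that by (auto simp: auto_def Bij_def bij_betw_def inj_on_def)
  have sub: "aut_both G M N \<subseteq> auto G"
    by (auto simp: aut_both_def aut_lower_def)
  show ?thesis
  proof (rule A.subgroupI)
    show "aut_both G M N \<subseteq> carrier (AutoGroup G)" using sub car by simp
    have "(\<lambda>x\<in>carrier G. x) \<in> aut_both G M N"
      using Msub Nsub M.id_in_auto
      by (auto simp: aut_both_def aut_lower_def aut_upper_def image_iff)
    then show "aut_both G M N \<noteq> {}" by blast
  next
    fix f assume f: "f \<in> aut_both G M N"
    then have fa: "f \<in> auto G" and fM: "f ` M = M"
      and ft: "\<And>x. x \<in> carrier G \<Longrightarrow> inv\<^bsub>G\<^esub> x \<otimes>\<^bsub>G\<^esub> f x \<in> M"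
      and fN: "\<And>x. x \<in> N \<Longrightarrow> f x = x"
      by (auto simp: aut_both_def aut_lower_def aut_upper_def)
    define g where "g = inv\<^bsub>AutoGroup G\<^esub> f"
    have ga: "g \<in> auto G" using A.inv_closed[of f] fa car by (simp add: g_def)
    have "f \<otimes>\<^bsub>AutoGroup G\<^esub> g = \<one>\<^bsub>AutoGroup G\<^esub>" using A.r_inv[of f] fa car by (simp add: g_def)
    then have fg: "f (g x) = x" if "x \<in> carrier G" for x
    proof -
      have "compose (carrier G) f g = (\<lambda>x\<in>carrier G. x)"
        using \<open>f \<otimes>\<^bsub>AutoGroup G\<^esub> g = \<one>\<^bsub>AutoGroup G\<^esub>\<close> mlt[OF fa ga]
        by (simp add: AutoGroup_def BijGroup_def)
      then show ?thesis using that by (metis compose_eq restrict_apply')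
    qed
    have gx: "g x \<in> M" if "x \<in> M" for x
    proof -
      from that fM obtain y where y: "y \<in> M" "x = f y" by blast
      then have "f (g x) = f y" using fg that Msub by auto
      moreover have "x \<in> carrier G" "y \<in> carrier G" using that y Msub by auto
      ultimately show ?thesis using tr[OF fa mem[OF ga]] y by simp
    qed
    have gM: "g ` M = M"
    proof
      show "g ` M \<subseteq> M" using gx by blast
      show "M \<subseteq> g ` M"
      proof
        fix x assume x: "x \<in> M"
        then have "f x \<in> M" using fM by blast
        moreover have xc: "x \<in> carrier G" using x Msub by auto
        have "f (g (f x)) = f x" using fg[OF mem[OF fa xc]] .
        then have "g (f x) = x" using tr[OF fa mem[OF ga mem[OF fa xc]] xc] by simp
        ultimately show "x \<in> g ` M" by force
      qed
    qed
    have gt: "inv\<^bsub>G\<^esub> x \<otimes>\<^bsub>G\<^esub> g x \<in> M" if x: "x \<in> carrier G" for x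
    proof -
      have "inv\<^bsub>G\<^esub> (g x) \<otimes>\<^bsub>G\<^esub> x \<in> M" using ft[OF mem[OF ga x]] fg[OF x] by simp
      then have "inv\<^bsub>G\<^esub> (inv\<^bsub>G\<^esub> (g x) \<otimes>\<^bsub>G\<^esub> x) \<in> M" by (rule M.m_inv_closed)
      then show ?thesis using mem[OF ga x] x by (simp add: M.inv_mult_group)
    qed
    have gN: "g x = x" if "x \<in> N" for x
      using fg[of x] fN[OF that] tr[OF fa, of "g x" x] mem[OF ga] that Nsub by auto
    show "inv\<^bsub>AutoGroup G\<^esub> f \<in> aut_both G M N"
      using ga gM gt gN by (simp add: aut_both_def aut_lower_def aut_upper_def flip: g_def)
  next
    fix f g assume f: "f \<in> aut_both G M N" and g: "g \<in> aut_both G M N"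
    have fa: "f \<in> auto G" and ga: "g \<in> auto G" using f g sub by auto
    have "f \<otimes>\<^bsub>AutoGroup G\<^esub> g \<in> auto G" using A.m_closed[of f g] fa ga car by simp
    moreover have "compose (carrier G) f g ` M = M"
    proof -
      have "compose (carrier G) f g ` M = f ` g ` M"
        using Msub by (force simp: compose_def image_image)
      then show ?thesis using f g by (simp add: aut_both_def aut_upper_def)
    qed
    moreover have "inv\<^bsub>G\<^esub> x \<otimes>\<^bsub>G\<^esub> f (g x) \<in> M" if x: "x \<in> carrier G" for x
    proof -
      have "inv\<^bsub>G\<^esub> x \<otimes>\<^bsub>G\<^esub> g x \<in> M" "inv\<^bsub>G\<^esub> (g x) \<otimes>\<^bsub>G\<^esub> f (g x) \<in> M"
        using f g x mem[OF ga x] by (auto simp: aut_both_def aut_upper_def)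
      then have "(inv\<^bsub>G\<^esub> x \<otimes>\<^bsub>G\<^esub> g x) \<otimes>\<^bsub>G\<^esub> (inv\<^bsub>G\<^esub> (g x) \<otimes>\<^bsub>G\<^esub> f (g x)) \<in> M"
        by (rule subgroup.m_closed[OF M.subgroup_axioms])
      moreover have "(inv\<^bsub>G\<^esub> x \<otimes>\<^bsub>G\<^esub> g x) \<otimes>\<^bsub>G\<^esub> (inv\<^bsub>G\<^esub> (g x) \<otimes>\<^bsub>G\<^esub> f (g x)) = inv\<^bsub>G\<^esub> x \<otimes>\<^bsub>G\<^esub> f (g x)"
        using x mem[OF ga x] mem[OF fa mem[OF ga x]]
        by (simp add: M.m_assoc flip: M.m_assoc[of "g x" "inv\<^bsub>G\<^esub> (g x)"])
      ultimately show ?thesis by simp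
    qed
    moreover have "f (g x) = x" if "x \<in> N" for x
      using f g that by (simp add: aut_both_def aut_lower_def)
    ultimately show "f \<otimes>\<^bsub>AutoGroup G\<^esub> g \<in> aut_both G M N"
      using Nsub mlt[OF fa ga]
      by (auto simp: aut_both_def aut_lower_def aut_upper_def compose_def)
  qed
qed

corollary group_aut_both_group:
  assumes "M \<lhd> G" and "N \<lhd> G"
  shows "group (aut_both_group G M N)"
proof -
  have "group G" using assms(1) by (simp add: normal_def)
  then show ?thesis
    unfolding aut_both_group_def
    using subgroup.subgroup_is_group[OF subgroup_aut_both[OF assms]] group.AutoGroup by blast
qed

lemma normal_PiE_product_group:
  assumes G: "\<And>i. i \<in> I \<Longrightarrow> group (H i)"
    and K: "\<And>i. i \<in> I \<Longrightarrow> K i \<lhd> H i"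
  shows "(\<Pi>\<^sub>E i\<in>I. K i) \<lhd> product_group I H"
proof -
  interpret P: group "product_group I H" using G by simp
  show ?thesis
    unfolding P.normal_inv_iff
  proof (intro conjI ballI)
    show "subgroup (Pi\<^sub>E I K) (product_group I H)"
      using K G by (simp add: PiE_subgroup_product_group normal_imp_subgroup)
    fix x h assume x: "x \<in> carrier (product_group I H)" and h: "h \<in> Pi\<^sub>E I K"
    have "x i \<otimes>\<^bsub>H i\<^esub> h i \<otimes>\<^bsub>H i\<^esub> inv\<^bsub>H i\<^esub> x i \<in> K i" if "i \<in> I" for i
      using x h that by (intro normal.inv_op_closed2[OF K]) auto
    then show "x \<otimes>\<^bsub>product_group I H\<^esub> h \<otimes>\<^bsub>product_group I H\<^esub> inv\<^bsub>product_group I H\<^esub> x \<in> Pi\<^sub>E I K"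
      using x G by (simp add: PiE_iff)
  qed
qed

end

theory Submission
  imports Defs
begin

text \<open>An automorphism \<open>f\<close> that is trivial modulo \<open>M\<close> moves only the \<open>j\<close>-th coordinate of a tuple.
  Splitting \<open>x\<close> as \<open>(1,\<dots>,x\<^sub>j,\<dots>,1)\<close> times a tuple in \<open>N\<close> with trivial \<open>j\<close>-th coordinate, which
  \<open>f\<close> fixes, shows that the new \<open>j\<close>-th coordinate depends on \<open>x\<^sub>j\<close> alone: \<open>f\<close> is \<open>\<alpha>\<^sub>f\<close> applied to that
  coordinate. Conversely, applying any \<open>a\<close> in $Aut_{N_j}^{M_j}(H_j)$ to the \<open>j\<close>-th coordinate gives
  an element of $Aut_N^M(G)$, so \<open>f \<mapsto> \<alpha>\<^sub>f\<close> is bijective.\<close>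

section \<open>Membership and multiplication in the automorphism groups\<close>

lemma aut_both_iff:
  "f \<in> aut_both G M N \<longleftrightarrow>
     f \<in> extensional (carrier G) \<and> bij_betw f (carrier G) (carrier G) \<and>
     (\<forall>x\<in>carrier G. \<forall>y\<in>carrier G. f (x \<otimes>\<^bsub>G\<^esub> y) = f x \<otimes>\<^bsub>G\<^esub> f y) \<and> f ` M = M \<and>
     (\<forall>x\<in>carrier G. inv\<^bsub>G\<^esub> x \<otimes>\<^bsub>G\<^esub> f x \<in> M) \<and> (\<forall>x\<in>N. f x = x)"
  by (auto simp: aut_both_def aut_upper_def aut_lower_def auto_def hom_def Bij_def
      dest: bij_betw_apply)

lemma aut_both_closed:
  "f \<in> aut_both G M N \<Longrightarrow> x \<in> carrier G \<Longrightarrow> f x \<in> carrier G"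
  by (auto simp: aut_both_iff dest: bij_betw_apply)

lemma carrier_aut_both_group [simp]: "carrier (aut_both_group G M N) = aut_both G M N"
  by (simp add: aut_both_group_def)

text \<open>The product of \<open>BijGroup\<close> is \<open>compose\<close> restricted to
  \<open>Bij\<close> in both arguments, so it unfolds only for members.\<close>

lemma mult_aut_both_group:
  assumes "f \<in> aut_both G M N" "g \<in> aut_both G M N"
  shows "f \<otimes>\<^bsub>aut_both_group G M N\<^esub> g = compose (carrier G) f g"
  using assms by (auto simp: aut_both_group_def AutoGroup_def BijGroup_def aut_both_iff Bij_def)

text \<open>The candidate inverse of \<open>factor_aut\<close>. It is restricted to the carrier
  because members of \<open>auto\<close> are extensional.\<close>

definition factor_lift ::
    "'i set \<Rightarrow> ('i \<Rightarrow> ('a, 'b) monoid_scheme) \<Rightarrow> 'i \<Rightarrow> ('a \<Rightarrow> 'a) \<Rightarrow> ('i \<Rightarrow> 'a) \<Rightarrow> ('i \<Rightarrow> 'a)" where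
  "factor_lift I H j a = (\<lambda>x \<in> carrier (product_group I H). x(j := a (x j)))"

section \<open>A product of groups with one distinguished factor\<close>

locale direct_factor =
  fixes I :: "'i set" and H :: "'i \<Rightarrow> ('a, 'b) monoid_scheme" and j :: 'i and Mj Nj :: "'a set"
  assumes groups: "\<And>i. i \<in> I \<Longrightarrow> group (H i)"
    and j_mem: "j \<in> I"
    and Mj_normal: "Mj \<lhd> H j" and Nj_normal: "Nj \<lhd> H j"
begin

abbreviation "G \<equiv> product_group I H"
abbreviation "M \<equiv> \<Pi>\<^sub>E i\<in>I. if i = j then Mj else {\<one>\<^bsub>H i\<^esub>}"
abbreviation "N \<equiv> \<Pi>\<^sub>E i\<in>I. if i = j then Nj else carrier (H i)"
abbreviation "inj_j \<equiv> factor_embed I H j"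
abbreviation "restr_j \<equiv> factor_aut I H j"
abbreviation "lift_j \<equiv> factor_lift I H j"

sublocale Hj: group "H j"
  by (rule groups[OF j_mem])

sublocale Mj: normal Mj "H j"
  by (rule Mj_normal)

sublocale Nj: normal Nj "H j"
  by (rule Nj_normal)

lemma one_closed_factor [simp]: "i \<in> I \<Longrightarrow> \<one>\<^bsub>H i\<^esub> \<in> carrier (H i)"
  by (simp add: groups group.is_monoid)

text \<open>Together with \<open>normal_N\<close>, this supplies the group structure of
  \<open>aut_both_group G M N\<close>.\<close>

lemma normal_M: "M \<lhd> G"
  by (rule normal_PiE_product_group) (auto simp: groups Mj_normal group.one_is_normal)

lemma normal_N: "N \<lhd> G"
proof (rule normal_PiE_product_group)
  fix i assume i: "i \<in> I"
  then interpret Hi: group "H i" by (rule groups)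
  have "carrier (H i) \<lhd> H i"
    by (simp add: Hi.normal_inv_iff Hi.subgroup_self)
  then show "(if i = j then Nj else carrier (H i)) \<lhd> H i"
    by (simp add: Nj_normal)
qed (rule groups)

section \<open>Embedding the distinguished factor and updating one coordinate\<close>

lemma embed_closed [simp]: "h \<in> carrier (H j) \<Longrightarrow> inj_j h \<in> carrier G"
  by (auto simp: factor_embed_def)

lemma embed_same [simp]: "inj_j h j = h"
  by (simp add: factor_embed_def j_mem)

lemma embed_mem_M: "h \<in> Mj \<Longrightarrow> inj_j h \<in> M"
  by (auto simp: factor_embed_def)

lemma embed_mem_N: "h \<in> Nj \<Longrightarrow> inj_j h \<in> N"
  by (auto simp: factor_embed_def)

lemma embed_mult:
  "inj_j (h \<otimes>\<^bsub>H j\<^esub> h') = inj_j h \<otimes>\<^bsub>G\<^esub> inj_j h'"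
  by (rule ext) (auto simp: factor_embed_def groups group.is_monoid)

lemma coord_closed [simp]: "x \<in> carrier G \<Longrightarrow> x j \<in> carrier (H j)"
  using j_mem by auto

lemma update_closed [simp]:
  "x \<in> carrier G \<Longrightarrow> h \<in> carrier (H j) \<Longrightarrow> x(j := h) \<in> carrier G"
  using j_mem by (auto simp: PiE_iff extensional_def)

section \<open>How members of \<open>aut_both G M N\<close> act on coordinates\<close>

lemma split_coord:
  assumes "x \<in> carrier G"
  shows "x = inj_j (x j) \<otimes>\<^bsub>G\<^esub> x(j := \<one>\<^bsub>H j\<^esub>)"
proof
  fix i
  \<comment> \<open>At \<open>j\<close> the right factor is trivial, at the other indices in
    \<open>I\<close> the left factor is, and outside \<open>I\<close> both sides are
    \<open>undefined\<close>.\<close>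
  show "x i = (inj_j (x j) \<otimes>\<^bsub>G\<^esub> x(j := \<one>\<^bsub>H j\<^esub>)) i"
    using assms by (auto simp: factor_embed_def PiE_iff extensional_def groups group.is_monoid)
qed

text \<open>The two conditions share the work: fixing \<open>N\<close> determines coordinate
  \<open>j\<close> of \<open>f x\<close> from \<open>x j\<close>, and triviality modulo
  \<open>M\<close> preserves the other coordinates.\<close>

lemma aut_both_apply:
  assumes f: "f \<in> aut_both G M N" and x: "x \<in> carrier G"
  shows "f x = x(j := restr_j f (x j))"
proof
  fix i
  have fx: "f x \<in> carrier G"
    using f x by (rule aut_both_closed)
  consider "i \<notin> I" | "i = j" | "i \<in> I" "i \<noteq> j" by blast
  then show "f x i = (x(j := restr_j f (x j))) i"
  proof cases
    case 1
    then show ?thesis using x fx j_mem by (auto simp: PiE_iff extensional_def)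
  next
    case 2
    \<comment> \<open>Coordinate \<open>j\<close> is the identity, which lies in the subgroup
      \<open>Nj\<close>, and \<open>N\<close> leaves the other coordinates free.\<close>
    have "x(j := \<one>\<^bsub>H j\<^esub>) \<in> N"
      using x j_mem by (auto simp: PiE_iff extensional_def)
    then have "f (x(j := \<one>\<^bsub>H j\<^esub>)) = x(j := \<one>\<^bsub>H j\<^esub>)"
      using f unfolding aut_both_iff by blast
    moreover have "f (inj_j (x j) \<otimes>\<^bsub>G\<^esub> x(j := \<one>\<^bsub>H j\<^esub>))
        = f (inj_j (x j)) \<otimes>\<^bsub>G\<^esub> f (x(j := \<one>\<^bsub>H j\<^esub>))"
      using f x unfolding aut_both_iff by (meson Hj.one_closed coord_closed embed_closed update_closed)
    ultimately have "f x = f (inj_j (x j)) \<otimes>\<^bsub>G\<^esub> x(j := \<one>\<^bsub>H j\<^esub>)"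
      using split_coord[OF x] by simp
    moreover have "f (inj_j (x j)) \<in> carrier G"
      by (rule aut_both_closed[OF f embed_closed[OF coord_closed[OF x]]])
    \<comment> \<open>Closure is needed to cancel the identity that the right factor contributes at
      coordinate \<open>j\<close>.\<close>
    then have "f (inj_j (x j)) j \<in> carrier (H j)" by (rule coord_closed)
    ultimately show ?thesis using 2 x j_mem coord_closed[OF x] by (simp add: factor_aut_def)
  next
    case 3
    interpret Hi: group "H i" by (rule groups) fact
    \<comment> \<open>Members of \<open>M\<close> are trivial off \<open>j\<close>, so this forces
      \<open>x i\<close> and \<open>f x i\<close> to coincide.\<close>
    have "inv\<^bsub>G\<^esub> x \<otimes>\<^bsub>G\<^esub> f x \<in> M"
      using f x unfolding aut_both_iff by blast
    then have "(inv\<^bsub>G\<^esub> x \<otimes>\<^bsub>G\<^esub> f x) i = \<one>\<^bsub>H i\<^esub>"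
      using 3 by (auto simp only: PiE_iff split: if_splits)
    then have "inv\<^bsub>H i\<^esub> x i \<otimes>\<^bsub>H i\<^esub> f x i = \<one>\<^bsub>H i\<^esub>"
      using 3 x groups by simp
    moreover have "x i \<in> carrier (H i)" "f x i \<in> carrier (H i)"
      using 3 x fx by auto
    ultimately have "f x i = x i"
      by (metis Hi.inv_closed Hi.inv_equality Hi.inv_inv Hi.inv_comm)
    then show ?thesis using 3 by simp
  qed
qed

section \<open>From automorphisms of the product to automorphisms of the factor\<close>

lemma restr_mem_aut_both:
  assumes f: "f \<in> aut_both G M N"
  shows "restr_j f \<in> aut_both (H j) Mj Nj"
proof -
  have bij: "bij_betw f (carrier G) (carrier G)" and fM: "f ` M = M"
    and mult: "\<And>x y. x \<in> carrier G \<Longrightarrow> y \<in> carrier G \<Longrightarrow> f (x \<otimes>\<^bsub>G\<^esub> y) = f x \<otimes>\<^bsub>G\<^esub> f y"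
    and triv: "\<And>x. x \<in> carrier G \<Longrightarrow> inv\<^bsub>G\<^esub> x \<otimes>\<^bsub>G\<^esub> f x \<in> M"
    and fN: "\<And>x. x \<in> N \<Longrightarrow> f x = x"
    using f unfolding aut_both_iff by blast+
  have M_coord: "x j \<in> Mj" if "x \<in> M" for x
    using that j_mem by (auto simp: PiE_iff split: if_splits)
  have M_carrier: "x \<in> carrier G" if "x \<in> M" for x
    using normal_imp_subgroup[OF normal_M] that by (rule subgroup.mem_carrier)
  have coord: "f x j = restr_j f (x j)" if "x \<in> carrier G" for x
    using aut_both_apply[OF f that] by simp
  have eq: "restr_j f h = f (inj_j h) j" if "h \<in> carrier (H j)" for h
    using that by (simp add: factor_aut_def)
  have fcl: "f x \<in> carrier G" if "x \<in> carrier G" for x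
    using bij that by (rule bij_betw_apply)
  have "inj_on (restr_j f) (carrier (H j))"
  proof (rule inj_onI)
    fix h h' assume h: "h \<in> carrier (H j)" "h' \<in> carrier (H j)" and "restr_j f h = restr_j f h'"
    \<comment> \<open>Embedded tuples differ only at \<open>j\<close>, where
      \<open>aut_both_apply\<close> puts the common value of \<open>restr_j f\<close>. Hence
      \<open>f\<close> takes the same value on both.\<close>
    moreover have "(inj_j h)(j := c) = (inj_j h')(j := c)" for c
      by (auto simp: factor_embed_def)
    ultimately have "f (inj_j h) = f (inj_j h')"
      using aut_both_apply[OF f] embed_closed embed_same by metis
    then have "inj_j h = inj_j h'"
      using bij h embed_closed unfolding bij_betw_def inj_on_def by blast
    then show "h = h'" by (metis embed_same)
  qed
  moreover have "restr_j f ` carrier (H j) = carrier (H j)"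
  proof
    show "restr_j f ` carrier (H j) \<subseteq> carrier (H j)"
      using coord_closed fcl by (auto simp: eq simp del: carrier_product_group)
    show "carrier (H j) \<subseteq> restr_j f ` carrier (H j)"
    proof
      fix y assume "y \<in> carrier (H j)"
      \<comment> \<open>The tuple \<open>x\<close> need not be presented as an embedded one:
        \<open>x j\<close> is already a preimage of \<open>y\<close>, since \<open>coord\<close>
        gives \<open>restr_j f (x j) = f x j = y\<close>.\<close>
      then obtain x where "x \<in> carrier G" "inj_j y = f x"
        using bij embed_closed unfolding bij_betw_def by blast
      then show "y \<in> restr_j f ` carrier (H j)"
        using coord coord_closed embed_same by (metis imageI)
    qed
  qed
  moreover have "restr_j f ` Mj = Mj"
  proof
    show "restr_j f ` Mj \<subseteq> Mj"
    proof (rule image_subsetI)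
      fix h assume h: "h \<in> Mj"
      then have "f (inj_j h) \<in> M" using fM embed_mem_M by blast
      then have "f (inj_j h) j \<in> Mj" by (rule M_coord)
      then show "restr_j f h \<in> Mj" using eq[OF Mj.mem_carrier[OF h]] by simp
    qed
    show "Mj \<subseteq> restr_j f ` Mj"
    proof
      fix y assume "y \<in> Mj"
      \<comment> \<open>Since \<open>f\<close> maps \<open>M\<close> onto itself, the preimage can
        be chosen in \<open>M\<close>, which puts \<open>x j\<close> in \<open>Mj\<close>.\<close>
      then obtain x where x: "x \<in> M" "inj_j y = f x"
        using fM embed_mem_M by blast
      then have "restr_j f (x j) = y"
        using coord[OF M_carrier[OF x(1)]] embed_same[of y] by simp
      with M_coord[OF x(1)] show "y \<in> restr_j f ` Mj"
        by (rule image_eqI[where f = "restr_j f", OF sym, rotated])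
    qed
  qed
  moreover have "restr_j f (h \<otimes>\<^bsub>H j\<^esub> h') = restr_j f h \<otimes>\<^bsub>H j\<^esub> restr_j f h'"
    if "h \<in> carrier (H j)" "h' \<in> carrier (H j)" for h h'
  proof -
    have "f (inj_j (h \<otimes>\<^bsub>H j\<^esub> h')) = f (inj_j h) \<otimes>\<^bsub>G\<^esub> f (inj_j h')"
      unfolding embed_mult using that by (intro mult embed_closed)
    then show ?thesis using that j_mem by (simp add: eq)
  qed
  moreover have "inv\<^bsub>H j\<^esub> h \<otimes>\<^bsub>H j\<^esub> restr_j f h \<in> Mj" if "h \<in> carrier (H j)" for h
  proof -
    \<comment> \<open>Triviality modulo \<open>Mj\<close> is coordinate \<open>j\<close> of
      triviality modulo \<open>M\<close> at the embedded element.\<close>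
    have "(inv\<^bsub>G\<^esub> inj_j h \<otimes>\<^bsub>G\<^esub> f (inj_j h)) j \<in> Mj"
      using M_coord triv embed_closed that by blast
    then show ?thesis
      using that j_mem embed_closed[OF that] groups by (simp add: eq)
  qed
  moreover have "restr_j f n = n" if "n \<in> Nj" for n
    using that fN[OF embed_mem_N[OF that]] Nj.mem_carrier by (simp add: eq)
  ultimately show ?thesis
    unfolding aut_both_iff bij_betw_def by (simp add: factor_aut_def)
qed

section \<open>From automorphisms of the factor to automorphisms of the product\<close>

lemma lift_apply: "x \<in> carrier G \<Longrightarrow> lift_j a x = x(j := a (x j))"
  by (simp add: factor_lift_def del: carrier_product_group)

text \<open>All operations are coordinatewise, so each condition at \<open>j\<close> reduces to the
  same condition on \<open>a\<close>, while the other coordinates do not move.\<close>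

lemma lift_mem_aut_both:
  assumes a: "a \<in> aut_both (H j) Mj Nj"
  shows "lift_j a \<in> aut_both G M N"
proof -
  have bij: "bij_betw a (carrier (H j)) (carrier (H j))" and aM: "a ` Mj = Mj"
    and mult: "\<And>x y. x \<in> carrier (H j) \<Longrightarrow> y \<in> carrier (H j) \<Longrightarrow> a (x \<otimes>\<^bsub>H j\<^esub> y) = a x \<otimes>\<^bsub>H j\<^esub> a y"
    and triv: "\<And>x. x \<in> carrier (H j) \<Longrightarrow> inv\<^bsub>H j\<^esub> x \<otimes>\<^bsub>H j\<^esub> a x \<in> Mj"
    and aN: "\<And>x. x \<in> Nj \<Longrightarrow> a x = x"
    using a unfolding aut_both_iff by blast+
  have acl: "a h \<in> carrier (H j)" if "h \<in> carrier (H j)" for h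
    using bij that by (rule bij_betw_apply)
  have M_carrier: "x \<in> carrier G" if "x \<in> M" for x
    using normal_imp_subgroup[OF normal_M] that by (rule subgroup.mem_carrier)
  have N_carrier: "x \<in> carrier G" if "x \<in> N" for x
    using normal_imp_subgroup[OF normal_N] that by (rule subgroup.mem_carrier)
  have M_coord: "x j \<in> Mj" if "x \<in> M" for x
    using that j_mem by (auto simp: PiE_iff split: if_splits)
  have N_coord: "x j \<in> Nj" if "x \<in> N" for x
    using that j_mem by (auto simp: PiE_iff split: if_splits)
  have M_update: "x(j := h) \<in> M" if "x \<in> M" "h \<in> Mj" for x h
    using that j_mem by (auto simp: PiE_iff extensional_def)
  have cl: "lift_j a x \<in> carrier G" if "x \<in> carrier G" for x
    using that acl coord_closed update_closed lift_apply by metis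
  have "inj_on (lift_j a) (carrier G)"
  proof (rule inj_onI)
    fix x y assume xy: "x \<in> carrier G" "y \<in> carrier G" and "lift_j a x = lift_j a y"
    then have eq: "x(j := a (x j)) = y(j := a (y j))"
      by (simp add: lift_apply del: carrier_product_group)
    have "a (x j) = a (y j)" using fun_cong[OF eq, of j] by simp
    then have "x j = y j"
      using bij xy coord_closed unfolding bij_betw_def inj_on_def by blast
    \<comment> \<open>The updated tuples agree, so \<open>x\<close> and \<open>y\<close> agree off
      \<open>j\<close>, and they agree at \<open>j\<close> by injectivity of
      \<open>a\<close>.\<close>
    then show "x = y" using eq by (metis fun_upd_triv fun_upd_upd)
  qed
  moreover have "lift_j a ` carrier G = carrier G"
  proof
    show "lift_j a ` carrier G \<subseteq> carrier G" using cl by blast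
    show "carrier G \<subseteq> lift_j a ` carrier G"
    proof
      fix y assume y: "y \<in> carrier G"
      then obtain h where h: "h \<in> carrier (H j)" "y j = a h"
        using bij coord_closed unfolding bij_betw_def by blast
      \<comment> \<open>The preimage of \<open>y\<close> replaces only coordinate \<open>j\<close>,
        by its preimage under \<open>a\<close>.\<close>
      have "y(j := h) \<in> carrier G" using y h by (intro update_closed)
      moreover from this have "lift_j a (y(j := h)) = y"
        using h by (simp add: lift_apply flip: h(2) del: carrier_product_group)
      ultimately show "y \<in> lift_j a ` carrier G" by (metis imageI)
    qed
  qed
  moreover have "lift_j a ` M = M"
  proof
    show "lift_j a ` M \<subseteq> M"
    proof (rule image_subsetI)
      fix x assume x: "x \<in> M"
      then have "a (x j) \<in> Mj" using M_coord aM by blast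
      then show "lift_j a x \<in> M"
        unfolding lift_apply[OF M_carrier[OF x]] by (rule M_update[OF x])
    qed
    show "M \<subseteq> lift_j a ` M"
    proof
      fix y assume y: "y \<in> M"
      then obtain h where h: "h \<in> Mj" "y j = a h"
        using aM M_coord by blast
      \<comment> \<open>Here \<open>h\<close> comes from \<open>Mj\<close>, because \<open>a\<close>
        maps \<open>Mj\<close> onto itself, so the preimage stays in \<open>M\<close>.\<close>
      have "y(j := h) \<in> M" using y h(1) by (rule M_update)
      moreover have "lift_j a (y(j := h)) = y"
        using lift_apply[OF M_carrier[OF \<open>y(j := h) \<in> M\<close>], of a] by (simp flip: h(2))
      ultimately show "y \<in> lift_j a ` M"
        by (rule image_eqI[where f = "lift_j a", OF sym, rotated])
    qed
  qed
  moreover have "lift_j a (x \<otimes>\<^bsub>G\<^esub> y) = lift_j a x \<otimes>\<^bsub>G\<^esub> lift_j a y"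
    if xy: "x \<in> carrier G" "y \<in> carrier G" for x y
  proof -
    interpret P: group G using groups by simp
    have "x \<otimes>\<^bsub>G\<^esub> y \<in> carrier G" using xy by (rule P.m_closed)
    moreover have "a ((x \<otimes>\<^bsub>G\<^esub> y) j) = a (x j) \<otimes>\<^bsub>H j\<^esub> a (y j)"
      using j_mem mult[OF coord_closed coord_closed] xy by simp
    ultimately show ?thesis
      using xy j_mem by (auto simp: lift_apply fun_eq_iff simp del: carrier_product_group)
  qed
  moreover have "inv\<^bsub>G\<^esub> x \<otimes>\<^bsub>G\<^esub> lift_j a x \<in> M" if x: "x \<in> carrier G" for x
  proof -
    \<comment> \<open>This covers the coordinates off \<open>j\<close>, where \<open>M\<close>
      demands the identity; at \<open>j\<close> the condition is \<open>triv\<close>.\<close>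
    have "inv\<^bsub>H i\<^esub> x i \<otimes>\<^bsub>H i\<^esub> x i = \<one>\<^bsub>H i\<^esub>" if "i \<in> I" for i
      using groups[OF that] x that by (auto intro: group.l_inv)
    then show ?thesis
      using x triv[OF coord_closed[OF x]] groups unfolding lift_apply[OF x] by auto
  qed
  moreover have "lift_j a x = x" if "x \<in> N" for x
    using lift_apply[OF N_carrier[OF that]] aN[OF N_coord[OF that]] by simp
  ultimately show ?thesis
    unfolding aut_both_iff bij_betw_def by (simp add: factor_lift_def)
qed

section \<open>Restriction and lifting as inverse maps, and the isomorphism\<close>

lemma restr_lift:
  assumes "a \<in> extensional (carrier (H j))"
  shows "restr_j (lift_j a) = a"
proof
  \<comment> \<open>Outside the carrier \<open>restr_j\<close> returns \<open>undefined\<close>,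
    which matches \<open>a\<close> by extensionality.\<close>
  fix h show "restr_j (lift_j a) h = a h"
    using assms lift_apply[OF embed_closed, of h a]
    by (cases "h \<in> carrier (H j)") (auto simp: factor_aut_def extensional_def)
qed

text \<open>On the carrier this is \<open>aut_both_apply\<close> read from right to left; outside it
  both sides are \<open>undefined\<close>.\<close>

lemma lift_restr:
  assumes "f \<in> aut_both G M N"
  shows "lift_j (restr_j f) = f"
proof
  fix x show "lift_j (restr_j f) x = f x"
  proof (cases "x \<in> carrier G")
    case True
    then show ?thesis using aut_both_apply[OF assms] lift_apply by metis
  next
    case False
    moreover have "f \<in> extensional (carrier G)"
      using assms unfolding aut_both_iff by blast
    ultimately have "f x = undefined" by (rule extensional_arb[rotated])
    then show ?thesis using False by (simp add: factor_lift_def del: carrier_product_group)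
  qed
qed

text \<open>Coordinate \<open>j\<close> of \<open>f (g (inj_j h))\<close> depends only on coordinate
  \<open>j\<close> of \<open>g (inj_j h)\<close>, which is \<open>restr_j g h\<close>.\<close>

lemma restr_compose:
  assumes f: "f \<in> aut_both G M N" and g: "g \<in> aut_both G M N"
  shows "restr_j (compose (carrier G) f g) = compose (carrier (H j)) (restr_j f) (restr_j g)"
proof
  fix h
  show "restr_j (compose (carrier G) f g) h = compose (carrier (H j)) (restr_j f) (restr_j g) h"
  proof (cases "h \<in> carrier (H j)")
    case True
    have "g (inj_j h) \<in> carrier G"
      using g embed_closed[OF True] by (rule aut_both_closed)
    then have "f (g (inj_j h)) j = restr_j f (g (inj_j h) j)"
      using aut_both_apply[OF f] by simp
    moreover have "g (inj_j h) j = restr_j g h"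
      using True by (simp add: factor_aut_def)
    moreover have "restr_j (compose (carrier G) f g) h = f (g (inj_j h)) j"
      using True embed_closed[OF True] by (simp add: factor_aut_def compose_def)
    ultimately show ?thesis using True by (simp add: compose_def)
  next
    case False
    then show ?thesis by (simp add: factor_aut_def compose_def)
  qed
qed

lemma restr_iso:
  "(\<lambda>f \<in> aut_both G M N. restr_j f)
     \<in> iso (aut_both_group G M N) (aut_both_group (H j) Mj Nj)"
proof (rule isoI)
  interpret A: group "aut_both_group G M N"
    using normal_M normal_N by (rule group_aut_both_group)
  show "(\<lambda>f \<in> aut_both G M N. restr_j f)
     \<in> hom (aut_both_group G M N) (aut_both_group (H j) Mj Nj)"
  proof (rule homI)
    fix f g
    assume "f \<in> carrier (aut_both_group G M N)" "g \<in> carrier (aut_both_group G M N)"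
    \<comment> \<open>The map agrees with \<open>restr_j\<close> only on
      \<open>aut_both G M N\<close>, so evaluating it at a product requires closure.\<close>
    moreover from this have "f \<otimes>\<^bsub>aut_both_group G M N\<^esub> g \<in> carrier (aut_both_group G M N)"
      by (rule A.m_closed)
    ultimately show "(\<lambda>f \<in> aut_both G M N. restr_j f) (f \<otimes>\<^bsub>aut_both_group G M N\<^esub> g)
        = (\<lambda>f \<in> aut_both G M N. restr_j f) f \<otimes>\<^bsub>aut_both_group (H j) Mj Nj\<^esub>
          (\<lambda>f \<in> aut_both G M N. restr_j f) g"
      using restr_mem_aut_both
      by (simp add: mult_aut_both_group restr_compose del: carrier_product_group)
  qed (simp add: restr_mem_aut_both)
  \<comment> \<open>The witness \<open>lift_j\<close> is a two-sided inverse; membership in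
    \<open>aut_both (H j) Mj Nj\<close> provides the extensionality that \<open>restr_lift\<close>
    assumes.\<close>
  have "bij_betw restr_j (aut_both G M N) (aut_both (H j) Mj Nj)"
    by (rule bij_betw_byWitness[where f' = lift_j])
      (use restr_mem_aut_both lift_mem_aut_both lift_restr restr_lift in \<open>auto simp only: aut_both_iff[of _ "H j"]\<close>)
  then show "bij_betw (\<lambda>f \<in> aut_both G M N. restr_j f)
      (carrier (aut_both_group G M N)) (carrier (aut_both_group (H j) Mj Nj))"
    by simp
qed

end

theorem theorem3p1:
  fixes H :: "nat \<Rightarrow> ('a, 'b) monoid_scheme"
    and k j :: nat
    and Mj Nj :: "'a set"
    and G :: "(nat \<Rightarrow> 'a) monoid"
    and M N :: "(nat \<Rightarrow> 'a) set"
  assumes "\<And>i. i \<in> {1..k} \<Longrightarrow> group (H i)"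
    and "G = product_group {1..k} H"
    and "j \<in> {1..k}"
    and "Mj \<lhd> H j" and "Nj \<lhd> H j"
    and "M = (\<Pi>\<^sub>E i\<in>{1..k}. if i = j then Mj else {\<one>\<^bsub>H i\<^esub>})"
    and "N = (\<Pi>\<^sub>E i\<in>{1..k}. if i = j then Nj else carrier (H i))"
  shows "(\<forall>f \<in> aut_both G M N.
            factor_aut {1..k} H j f \<in> auto (H j) \<and>
            factor_aut {1..k} H j f \<in> aut_both (H j) Mj Nj)
       \<and> (\<lambda>f \<in> aut_both G M N. factor_aut {1..k} H j f)
            \<in> iso (aut_both_group G M N) (aut_both_group (H j) Mj Nj)"
proof -
  interpret direct_factor "{1..k}" H j Mj Nj
    by (rule direct_factor.intro) (use assms in blast)+
  have "factor_aut {1..k} H j f \<in> auto (H j)"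
    if "factor_aut {1..k} H j f \<in> aut_both (H j) Mj Nj" for f
    using that by (simp add: aut_both_def aut_upper_def)
  then show ?thesis
    unfolding assms(2,6,7) using restr_mem_aut_both restr_iso by blast
qed

end
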